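(* Let $\mathcal{E}$ be a finite axiom system over CCS that is sound modulo $\sim_{\mathtt{RWB}}$. Then there exists some $n\ge1$ such that $\mathcal{E}\not\vdash M_n$, where $M_n$ is the equation $$(x+y)\,\|\,\sum_{i=1}^n z_i+\sum_{i=1}^n\big(x\,\|\,z_i+y\,\|\,z_i\big)\;\approx\;x\,\|\,\sum_{i=1}^n z_i+y\,\|\,\sum_{i=1}^n z_i+\sum_{i=1}^n\big((x+y)\,\|\,z_i\big)$$ with $x,y,z_1,\dots,z_n$ distinct variables.
   Context: Let $\mathcal{A}$ be a nonempty set of action names, $\overline{\mathcal{A}}$ the co-names ($\overline{\overline{a}}=a\neq\overline{a}$), $\mathcal{A}_\tau=\mathcal{A}\cup\overline{\mathcal{A}}\cup\{\tau\}$. CCS terms: $t ::= \mathbf{0} \mid x \mid \mu.t \mid t+t \mid t\,\|\,t$, $x$ a variable, $\mu\in\mathcal{A}_\tau$; closed terms are processes. Transitions: $\mu.p\xrightarrow{\mu}p$; if $p\xrightarrow{\mu}p'$ then $p+q\xrightarrow{\mu}p'$, $q+p\xrightarrow{\mu}p'$, $p\|q\xrightarrow{\mu}p'\|q$, $q\|p\xrightarrow{\mu}q\|p'$; if $p\xrightarrow{\alpha}p'$, $q\xrightarrow{\overline\alpha}q'$ ($\alpha\in\mathcal{A}\cup\overline{\mathcal{A}}$) then $p\|q\xrightarrow{\tau}p'\|q'$. With $\xrightarrow{\varepsilon}$ the reflexive-transitive closure of $\xrightarrow{\tau}$, $p\xRightarrow{\mu}q$ means $p\xrightarrow{\varepsilon}\xrightarrow{\mu}\xrightarrow{\varepsilon}q$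 for $\mu\ne\tau$ and $p\xrightarrow{\varepsilon}q$ for $\mu=\tau$, and $p\xRightarrow{\hat\mu}q$ means $p\xrightarrow{\varepsilon}\xrightarrow{\mu}\xrightarrow{\varepsilon}q$. Weak bisimilarity $\sim_{\mathtt{WB}}$: largest symmetric relation such that if $p\sim_{\mathtt{WB}}q$ and $p\xrightarrow{\mu}p'$ then either $\mu=\tau$ and $p'\sim_{\mathtt{WB}}q$, or $q\xRightarrow{\mu}q'$ with $p'\sim_{\mathtt{WB}}q'$. Rooted weak bisimilarity: $p\sim_{\mathtt{RWB}}q$ iff each $p\xrightarrow{\mu}p'$ is matched by $q\xRightarrow{\hat\mu}q'$ with $p'\sim_{\mathtt{WB}}q'$, and symmetrically. An equation is sound modulo $\sim_{\mathtt{RWB}}$ if all its closed instances are related by $\sim_{\mathtt{RWB}}$. $\mathcal{E}\vdash t\approx u$ denotes derivability by equational logic: reflexivity, symmetry, transitivity, substitution instances of axioms of $\mathcal{E}$, and congruence rules for $\mu.\,\cdot$, $+$ and $\|$. *)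

theory Defs
  imports Main
begin

(* The type parameter is the set of action names (every HOL type is nonempty);
   it may be finite or infinite. *)

datatype 'a label = Name 'a | CoName 'a

fun co :: "'a label \<Rightarrow> 'a label" where
  "co (Name a) = CoName a"
| "co (CoName a) = Name a"

datatype 'a act = Vis "'a label" | Tau

type_synonym var = nat

datatype 'a trm =
    Zero
  | Var var
  | Pre "'a act" "'a trm"
  | Plus "'a trm" "'a trm"  (infixl "\<oplus>" 65)
  | Par "'a trm" "'a trm"  (infixl "\<parallel>" 70)

primrec vars :: "'a trm \<Rightarrow> var set" where
  "vars Zero = {}"
| "vars (Var x) = {x}"
| "vars (Pre \<mu> t) = vars t"
| "vars (t \<oplus> u) = vars t \<union> vars u"
| "vars (t \<parallel> u) = vars t \<union> vars u"

definition closed :: "'a trm \<Rightarrow> bool" where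
  "closed t \<longleftrightarrow> vars t = {}"

primrec subst :: "(var \<Rightarrow> 'a trm) \<Rightarrow> 'a trm \<Rightarrow> 'a trm" where
  "subst \<sigma> Zero = Zero"
| "subst \<sigma> (Var x) = \<sigma> x"
| "subst \<sigma> (Pre \<mu> t) = Pre \<mu> (subst \<sigma> t)"
| "subst \<sigma> (t \<oplus> u) = subst \<sigma> t \<oplus> subst \<sigma> u"
| "subst \<sigma> (t \<parallel> u) = subst \<sigma> t \<parallel> subst \<sigma> u"

(* Transitions are defined on all terms (a variable has none), but the
   equivalences below relate closed terms only. *)

inductive step :: "'a trm \<Rightarrow> 'a act \<Rightarrow> 'a trm \<Rightarrow> bool" where
  prefix: "step (Pre \<mu> p) \<mu> p"
| plus_left: "step p \<mu> p' \<Longrightarrow> step (p \<oplus> q) \<mu> p'"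
| plus_right: "step p \<mu> p' \<Longrightarrow> step (q \<oplus> p) \<mu> p'"
| par_left: "step p \<mu> p' \<Longrightarrow> step (p \<parallel> q) \<mu> (p' \<parallel> q)"
| par_right: "step p \<mu> p' \<Longrightarrow> step (q \<parallel> p) \<mu> (q \<parallel> p')"
| comm: "step p (Vis \<alpha>) p' \<Longrightarrow> step q (Vis (co \<alpha>)) q' \<Longrightarrow> step (p \<parallel> q) Tau (p' \<parallel> q')"

definition eps :: "'a trm \<Rightarrow> 'a trm \<Rightarrow> bool" where
  "eps = (\<lambda>p q. step p Tau q)\<^sup>*\<^sup>*"

(* At least one \<mu>-step, also for \<mu> = Tau; the move used for the root condition. *)

definition weak_step_strict :: "'a trm \<Rightarrow> 'a act \<Rightarrow> 'a trm \<Rightarrow> bool" where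
  "weak_step_strict p \<mu> q \<longleftrightarrow> (\<exists>p' q'. eps p p' \<and> step p' \<mu> q' \<and> eps q' q)"

definition weak_step :: "'a trm \<Rightarrow> 'a act \<Rightarrow> 'a trm \<Rightarrow> bool" where
  "weak_step p \<mu> q \<longleftrightarrow> (if \<mu> = Tau then eps p q else weak_step_strict p \<mu> q)"

definition weak_bisimulation :: "('a trm \<Rightarrow> 'a trm \<Rightarrow> bool) \<Rightarrow> bool" where
  "weak_bisimulation R \<longleftrightarrow>
     (\<forall>p q. R p q \<longrightarrow> closed p \<and> closed q) \<and>
     symp R \<and>
     (\<forall>p q \<mu> p'. R p q \<longrightarrow> step p \<mu> p' \<longrightarrow>
        (\<mu> = Tau \<and> R p' q) \<or> (\<exists>q'. weak_step q \<mu> q' \<and> R p' q'))"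

definition WB :: "'a trm \<Rightarrow> 'a trm \<Rightarrow> bool" where
  "WB p q \<longleftrightarrow> (\<exists>R. weak_bisimulation R \<and> R p q)"

lemma weak_bisimulation_le_WB: "weak_bisimulation R \<Longrightarrow> R p q \<Longrightarrow> WB p q"
  unfolding WB_def by (intro exI conjI)

lemma weak_bisimulation_WB: "weak_bisimulation WB"
  unfolding weak_bisimulation_def
proof (intro conjI allI impI sympI)
  fix p q :: "'a trm"
  assume "WB p q"
  then obtain R where R: "weak_bisimulation R" and pq: "R p q"
    unfolding WB_def by (elim exE conjE)
  note D = R[unfolded weak_bisimulation_def]
  show "closed p"
    using D[THEN conjunct1] pq by simp
  show "closed q"
    using D[THEN conjunct1] pq by simp
  show "WB q p"
    using weak_bisimulation_le_WB[OF R] sympD[OF D[THEN conjunct2, THEN conjunct1] pq] .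
next
  fix p q :: "'a trm" and \<mu> p'
  assume "WB p q" and s: "step p \<mu> p'"
  then obtain R where R: "weak_bisimulation R" and pq: "R p q"
    unfolding WB_def by (elim exE conjE)
  have "(\<mu> = Tau \<and> R p' q) \<or> (\<exists>q'. weak_step q \<mu> q' \<and> R p' q')"
    using R[unfolded weak_bisimulation_def, THEN conjunct2, THEN conjunct2,
        THEN spec, THEN spec, THEN spec, THEN spec, THEN mp, THEN mp, OF pq s] .
  then show "(\<mu> = Tau \<and> WB p' q) \<or> (\<exists>q'. weak_step q \<mu> q' \<and> WB p' q')"
    using weak_bisimulation_le_WB[OF R] by metis
qed

definition RWB :: "'a trm \<Rightarrow> 'a trm \<Rightarrow> bool" where
  "RWB p q \<longleftrightarrow>
     closed p \<and> closed q \<and>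
     (\<forall>\<mu> p'. step p \<mu> p' \<longrightarrow> (\<exists>q'. weak_step_strict q \<mu> q' \<and> WB p' q')) \<and>
     (\<forall>\<mu> q'. step q \<mu> q' \<longrightarrow> (\<exists>p'. weak_step_strict p \<mu> p' \<and> WB p' q'))"

type_synonym 'a axsys = "('a trm \<times> 'a trm) set"

definition sound_eq :: "'a trm \<Rightarrow> 'a trm \<Rightarrow> bool" where
  "sound_eq t u \<longleftrightarrow> (\<forall>\<sigma>. (\<forall>x. closed (\<sigma> x)) \<longrightarrow> RWB (subst \<sigma> t) (subst \<sigma> u))"

definition sound :: "'a axsys \<Rightarrow> bool" where
  "sound E \<longleftrightarrow> (\<forall>(t, u) \<in> E. sound_eq t u)"

inductive derives :: "'a axsys \<Rightarrow> 'a trm \<Rightarrow> 'a trm \<Rightarrow> bool"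
  ("_ \<turnstile> _ \<approx> _" [50, 51, 51] 50) for E where
  refl: "E \<turnstile> t \<approx> t"
| sym: "E \<turnstile> t \<approx> u \<Longrightarrow> E \<turnstile> u \<approx> t"
| trans: "E \<turnstile> t \<approx> u \<Longrightarrow> E \<turnstile> u \<approx> v \<Longrightarrow> E \<turnstile> t \<approx> v"
| axm: "(t, u) \<in> E \<Longrightarrow> E \<turnstile> subst \<sigma> t \<approx> subst \<sigma> u"
| cong_pre: "E \<turnstile> t \<approx> u \<Longrightarrow> E \<turnstile> Pre \<mu> t \<approx> Pre \<mu> u"
| cong_plus: "E \<turnstile> t \<approx> u \<Longrightarrow> E \<turnstile> t' \<approx> u' \<Longrightarrow> E \<turnstile> t \<oplus> t' \<approx> u \<oplus> u'"
| cong_par: "E \<turnstile> t \<approx> u \<Longrightarrow> E \<turnstile> t' \<approx> u' \<Longrightarrow> E \<turnstile> t \<parallel> t' \<approx> u \<parallel> u'"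

(* tsum f n = f 1 + ... + f n, bracketed to the left, without a spurious
   summand Zero when n > 0. *)

fun tsum :: "(nat \<Rightarrow> 'a trm) \<Rightarrow> nat \<Rightarrow> 'a trm" where
  "tsum f 0 = Zero"
| "tsum f (Suc 0) = f 1"
| "tsum f (Suc (Suc n)) = tsum f (Suc n) \<oplus> f (Suc (Suc n))"

definition M_lhs :: "nat \<Rightarrow> var \<Rightarrow> var \<Rightarrow> (nat \<Rightarrow> var) \<Rightarrow> 'a trm" where
  "M_lhs n x y z =
     (Var x \<oplus> Var y) \<parallel> tsum (\<lambda>i. Var (z i)) n
     \<oplus> tsum (\<lambda>i. Var x \<parallel> Var (z i) \<oplus> Var y \<parallel> Var (z i)) n"

definition M_rhs :: "nat \<Rightarrow> var \<Rightarrow> var \<Rightarrow> (nat \<Rightarrow> var) \<Rightarrow> 'a trm" where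
  "M_rhs n x y z =
     Var x \<parallel> tsum (\<lambda>i. Var (z i)) n \<oplus> Var y \<parallel> tsum (\<lambda>i. Var (z i)) n
     \<oplus> tsum (\<lambda>i. (Var x \<oplus> Var y) \<parallel> Var (z i)) n"

end

theory Submission
  imports Defs "HOL-Library.FSet"
begin

text \<open>
  Substituting \<^term>\<open>Zero\<close> for all variables shows that every term in a derivation of \<open>M\<^sub>n\<close> from
  sound axioms is free of prefixes. Such terms are interpreted in the hereditarily finite sets,
  which are the finite processes over a single action modulo strong bisimilarity: \<open>+\<close> is union
  and \<open>\<parallel>\<close> is interleaving. Closed terms over one action have neither \<open>\<tau>\<close>-steps nor
  communications, so sound equations between prefix-free terms hold in this algebra.

  A process that can reach the empty process in one step is irreducible with respect to \<open>\<parallel>\<close>.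
  Take irreducible values for \<open>x\<close>, \<open>y\<close>, \<open>z\<^sub>i\<close>, and let \<open>w\<close> be the value of
  \<open>(x + y) \<parallel> (z\<^sub>1 + \<dots> + z\<^sub>n)\<close>. The left-hand side of \<open>M\<^sub>n\<close> has a summand with value
  \<open>w\<close>, the right-hand side has none. An axiom \<open>t \<approx> u\<close> with fewer than \<open>n\<close> symbols
  preserves the existence of such a summand: by unique decomposition a summand \<open>p \<parallel> q\<close> of \<open>t\<close>
  with value \<open>w\<close> has \<open>p\<close> worth \<open>x + y\<close> and \<open>q\<close> worth the sum of the \<open>z\<^sub>i\<close>, and by the
  pigeonhole principle some variable \<open>v\<close> of \<open>q\<close> covers the steps of two different \<open>z\<^sub>i\<close>.
  Changing the value of \<open>v\<close> to one step followed by a very deep irreducible process reveals a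
  summand \<open>a \<parallel> b\<close> of \<open>u\<close> with \<open>b\<close> worth \<open>x + y\<close> and \<open>v\<close> a summand of \<open>a\<close>; since two
  different \<open>z\<^sub>i\<close> contribute to \<open>a\<close>, it is worth the whole sum.
\<close>

section \<open>Hereditarily finite sets with interleaving\<close>

datatype hf = HF (elts: "hf fset")

definition ch :: "hf \<Rightarrow> hf set" where
  "ch p = fset (elts p)"

definition node :: "hf set \<Rightarrow> hf" where
  "node A = HF (Abs_fset A)"

lemma finite_ch [simp]: "finite (ch p)"
  by (simp add: ch_def)

lemma ch_node [simp]: "finite A \<Longrightarrow> ch (node A) = A"
  by (simp add: ch_def node_def Abs_fset_inverse)

lemma node_ch [simp]: "node (ch p) = p"
  by (simp add: ch_def node_def fset_inverse)

lemma ch_inject [simp]: "ch p = ch q \<longleftrightarrow> p = q"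
  by (metis node_ch)

lemma hf_induct [case_names node]:
  assumes "\<And>p. (\<And>p'. p' \<in> ch p \<Longrightarrow> P p') \<Longrightarrow> P p"
  shows "P p"
proof (induction p)
  case (HF A)
  show ?case by (rule assms, rule HF) (simp add: ch_def)
qed

primrec depth :: "hf \<Rightarrow> nat" where
  "depth (HF A) = Max (insert 0 (Suc ` fset (depth |`| A)))"

lemma depth_eq: "depth p = Max (insert 0 (Suc ` depth ` ch p))"
  by (cases p) (simp add: ch_def)

lemma depth_less: "p' \<in> ch p \<Longrightarrow> depth p' < depth p"
  by (subst (2) depth_eq) (auto simp: less_eq_Suc_le intro!: Max_ge)

lemma depth_le: "(\<And>p'. p' \<in> ch p \<Longrightarrow> depth p' < d) \<Longrightarrow> depth p \<le> d"
  by (subst depth_eq) (auto intro: Suc_leI)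

lemma depth_attained:
  assumes "depth p \<noteq> 0"
  obtains p' where "p' \<in> ch p" "depth p = Suc (depth p')"
proof -
  have "Max (insert 0 (Suc ` depth ` ch p)) \<in> insert 0 (Suc ` depth ` ch p)"
    by (intro Max_in) auto
  then have "depth p \<in> insert 0 (Suc ` depth ` ch p)"
    by (subst depth_eq)
  then show thesis using assms that by auto
qed

definition nil :: hf where
  "nil = node {}"

lemma ch_nil [simp]: "ch nil = {}"
  by (simp add: nil_def)

lemma ch_eq_empty [simp]: "ch p = {} \<longleftrightarrow> p = nil"
  by (metis ch_inject ch_nil)

lemma depth_nil [simp]: "depth nil = 0"
  by (subst depth_eq) simp

lemma depth_eq_0 [simp]: "depth p = 0 \<longleftrightarrow> p = nil"
  by (metis all_not_in_conv ch_eq_empty depth_less depth_nil not_less_zero)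

definition hplus :: "hf \<Rightarrow> hf \<Rightarrow> hf" where
  "hplus p q = node (ch p \<union> ch q)"

lemma ch_hplus [simp]: "ch (hplus p q) = ch p \<union> ch q"
  by (simp add: hplus_def)

lemma depth_hplus [simp]: "depth (hplus p q) = max (depth p) (depth q)"
proof (rule antisym)
  show "depth (hplus p q) \<le> max (depth p) (depth q)"
    by (rule depth_le) (auto dest: depth_less)
  have "depth r \<le> depth (hplus p q)" if "ch r \<subseteq> ch (hplus p q)" for r
    using that depth_less[of _ "hplus p q"] by (intro depth_le) blast
  then show "max (depth p) (depth q) \<le> depth (hplus p q)" by simp
qed

lemma hplus_eq_nil [simp]: "hplus p q = nil \<longleftrightarrow> p = nil \<and> q = nil"
  by (metis Un_empty ch_eq_empty ch_hplus)

function hpar :: "hf \<Rightarrow> hf \<Rightarrow> hf" (infixl "\<bowtie>" 70) where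
  "p \<bowtie> q = node ((\<lambda>p'. p' \<bowtie> q) ` ch p \<union> (\<lambda>q'. p \<bowtie> q') ` ch q)"
  by auto
termination
  by (relation "measure (\<lambda>(p, q). depth p + depth q)") (auto dest: depth_less)

declare hpar.simps [simp del]

lemma ch_hpar: "ch (p \<bowtie> q) = (\<lambda>p'. p' \<bowtie> q) ` ch p \<union> (\<lambda>q'. p \<bowtie> q') ` ch q"
  by (subst hpar.simps) simp

lemma hpar_left: "p' \<in> ch p \<Longrightarrow> p' \<bowtie> q \<in> ch (p \<bowtie> q)"
  by (simp add: ch_hpar)

lemma hpar_right: "q' \<in> ch q \<Longrightarrow> p \<bowtie> q' \<in> ch (p \<bowtie> q)"
  by (simp add: ch_hpar)

lemma hpar_cases:
  assumes "r \<in> ch (p \<bowtie> q)"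
  obtains p' where "p' \<in> ch p" "r = p' \<bowtie> q" | q' where "q' \<in> ch q" "r = p \<bowtie> q'"
  using assms by (auto simp: ch_hpar)

lemma hpar_nil_right [simp]: "p \<bowtie> nil = p"
proof (induction p rule: hf_induct)
  case (node p)
  then show ?case by (subst ch_inject[symmetric], subst ch_hpar) simp
qed

lemma hpar_commute: "p \<bowtie> q = q \<bowtie> p"
proof (induction p arbitrary: q rule: hf_induct)
  case p: (node p)
  show ?case
  proof (induction q rule: hf_induct)
    case (node q)
    have "(\<lambda>p'. p' \<bowtie> q) ` ch p = (\<lambda>p'. q \<bowtie> p') ` ch p"
      "(\<lambda>q'. p \<bowtie> q') ` ch q = (\<lambda>q'. q' \<bowtie> p) ` ch q"
      by (rule image_cong[OF HOL.refl], use p node in blast)+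
    then have "ch (p \<bowtie> q) = ch (q \<bowtie> p)"
      by (simp only: ch_hpar Un_commute)
    then show ?case by simp
  qed
qed

lemma hpar_nil_left [simp]: "nil \<bowtie> p = p"
  by (simp add: hpar_commute[of nil])

lemma hpar_assoc: "(p \<bowtie> q) \<bowtie> r = p \<bowtie> (q \<bowtie> r)"
proof (induction "depth p + depth q + depth r" arbitrary: p q r rule: less_induct)
  case less
  have *: "p' \<in> ch p \<Longrightarrow> (p' \<bowtie> q) \<bowtie> r = p' \<bowtie> (q \<bowtie> r)"
     "q' \<in> ch q \<Longrightarrow> (p \<bowtie> q') \<bowtie> r = p \<bowtie> (q' \<bowtie> r)"
     "r' \<in> ch r \<Longrightarrow> (p \<bowtie> q) \<bowtie> r' = p \<bowtie> (q \<bowtie> r')" for p' q' r'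
    by (auto intro!: less dest: depth_less)
  have "ch ((p \<bowtie> q) \<bowtie> r) = ch (p \<bowtie> (q \<bowtie> r))"
    using * by (subst (1 2) ch_hpar) (auto simp: ch_hpar[of p q] ch_hpar[of q r] image_Un image_image)
  then show ?case by simp
qed

lemma hpar_right_commute: "(p \<bowtie> q) \<bowtie> r = (p \<bowtie> r) \<bowtie> q"
  by (simp only: hpar_assoc hpar_commute[of q])

text \<open>Longest runs interleave, so depth is additive; many factorisations below are excluded by
  comparing depths.\<close>

lemma depth_hpar [simp]: "depth (p \<bowtie> q) = depth p + depth q"
proof (induction "depth p + depth q" arbitrary: p q rule: less_induct)
  case less
  have l: "depth (p' \<bowtie> q) = depth p' + depth q" if "p' \<in> ch p" for p'
    using less that by (auto dest: depth_less)
  have r: "depth (p \<bowtie> q') = depth p + depth q'" if "q' \<in> ch q" for q'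
    using less that by (auto dest: depth_less)
  show ?case
  proof (rule antisym)
    show "depth (p \<bowtie> q) \<le> depth p + depth q"
      by (rule depth_le) (auto elim!: hpar_cases simp: l r dest: depth_less)
    show "depth p + depth q \<le> depth (p \<bowtie> q)"
    proof (cases "depth p = 0")
      case False
      then obtain p' where p': "p' \<in> ch p" "depth p = Suc (depth p')"
        by (rule depth_attained)
      then show ?thesis using depth_less[OF hpar_left[OF p'(1), of q]] l by simp
    qed simp
  qed
qed

lemma hpar_eq_nil [simp]:
  "p \<bowtie> q = nil \<longleftrightarrow> p = nil \<and> q = nil" "nil = p \<bowtie> q \<longleftrightarrow> p = nil \<and> q = nil"
  by (metis add_is_0 depth_eq_0 depth_hpar)+

text \<open>A step of \<open>p \<bowtie> q\<close> to \<open>nil\<close> moves one component and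
  leaves the other, which must therefore be \<open>nil\<close> already.\<close>

lemma irreducible:
  assumes "p \<bowtie> q = r" "nil \<in> ch r"
  shows "p = nil \<and> q = r \<or> q = nil \<and> p = r"
proof -
  have "nil \<in> ch (p \<bowtie> q)" using assms by simp
  then show ?thesis using assms(1) by (auto elim!: hpar_cases)
qed

text \<open>Both \<open>a\<close> and \<open>b\<close> can vanish, so each is a step of the product.
  A step of \<open>p \<bowtie> q\<close> to an irreducible \<open>c\<close> erases one component and
  leaves the other equal to \<open>c\<close>.\<close>

lemma two_factors:
  assumes eq: "p \<bowtie> q = a \<bowtie> b" and a: "nil \<in> ch a" and b: "nil \<in> ch b" and "a \<noteq> b"
    and "p \<noteq> nil" "q \<noteq> nil"
  shows "p = a \<and> q = b \<or> p = b \<and> q = a"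
proof -
  have "p = c \<or> q = c" if "c \<in> ch (p \<bowtie> q)" "nil \<in> ch c" for c
    using that(1)
  proof (cases rule: hpar_cases)
    case (1 p')
    then show ?thesis using irreducible[of p' q c] that(2) \<open>q \<noteq> nil\<close> by auto
  next
    case (2 q')
    then show ?thesis using irreducible[of p q' c] that(2) \<open>p \<noteq> nil\<close> by auto
  qed
  moreover have "b \<in> ch (p \<bowtie> q)" "a \<in> ch (p \<bowtie> q)"
    using hpar_left[OF a, of b] hpar_right[OF b, of a] by (simp_all add: eq)
  ultimately show ?thesis using a b \<open>a \<noteq> b\<close> by metis
qed

text \<open>An irreducible process of each positive depth.\<close>

primrec cc :: "nat \<Rightarrow> hf" where
  "cc 0 = nil"
| "cc (Suc k) = node {nil, cc k}"

lemma ch_cc_Suc [simp]: "ch (cc (Suc k)) = {nil, cc k}"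
  by simp

lemma depth_cc [simp]: "depth (cc k) = k"
proof (induction k)
  case (Suc k)
  then show ?case by (subst depth_eq) simp
qed simp

lemma cc_inject [simp]: "cc i = cc j \<longleftrightarrow> i = j"
  by (metis depth_cc)

lemma cc_eq_nil [simp]: "cc i = nil \<longleftrightarrow> i = 0" "nil = cc i \<longleftrightarrow> i = 0"
  using cc_inject[of i 0] by auto

lemma nil_in_cc [simp]: "nil \<in> ch (cc k) \<longleftrightarrow> k > 0"
  by (cases k) auto

declare cc.simps(2) [simp del]

text \<open>If \<open>f\<close> is irreducible, letting it vanish makes \<open>cc j\<close> a step
  of \<open>r \<bowtie> cc g\<close>. As \<open>j < g\<close>, this step moves \<open>cc g\<close>,
  and irreducibility of \<open>cc j\<close> leaves \<open>r = nil\<close> or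
  \<open>r = cc j\<close>; the first contradicts irreducibility of \<open>cc g\<close>, the second
  contradicts depth.\<close>

lemma cc_not_factor:
  assumes eq: "f \<bowtie> cc j = r \<bowtie> cc g" and "0 < j" "j < g" "depth f < g"
    and f: "f = nil \<or> nil \<in> ch f"
  shows False
  using f
proof
  assume "f = nil"
  then have "depth (cc j) = depth (r \<bowtie> cc g)" using eq by simp
  then show False using \<open>j < g\<close> by simp
next
  assume "nil \<in> ch f"
  then have "cc j \<in> ch (r \<bowtie> cc g)" using eq hpar_left[of nil f "cc j"] by simp
  then show False
  proof (cases rule: hpar_cases)
    case (1 p')
    then have "depth (cc j) = depth (p' \<bowtie> cc g)" by simp
    then show False using \<open>j < g\<close> by simp
  next
    case (2 q')
    then consider "r = nil" | "r = cc j"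
      using irreducible[of r q' "cc j"] \<open>0 < j\<close> nil_in_cc by metis
    then show False
    proof cases
      case 1
      then have "f \<bowtie> cc j = cc g" using eq by simp
      then show False using irreducible[of f "cc j" "cc g"] assms \<open>nil \<in> ch f\<close> by auto
    next
      case 2
      have "depth (f \<bowtie> cc j) = depth (r \<bowtie> cc g)" using eq by simp
      then show False using 2 \<open>depth f < g\<close> by simp
    qed
  qed
qed

section \<open>Soundness in the algebra of hereditarily finite sets\<close>

text \<open>Prefixes forget their action. This agrees with the transitions on terms satisfying
  \<open>only a\<close>.\<close>

primrec ev :: "(var \<Rightarrow> hf) \<Rightarrow> 'a trm \<Rightarrow> hf" where
  "ev \<rho> Zero = nil"
| "ev \<rho> (Var x) = \<rho> x"
| "ev \<rho> (Pre \<mu> t) = node {ev \<rho> t}"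
| "ev \<rho> (t \<oplus> u) = hplus (ev \<rho> t) (ev \<rho> u)"
| "ev \<rho> (t \<parallel> u) = ev \<rho> t \<bowtie> ev \<rho> u"

lemma ev_subst: "ev \<rho> (subst \<sigma> t) = ev (\<lambda>v. ev \<rho> (\<sigma> v)) t"
  by (induction t) simp_all

lemma ev_cong: "(\<And>v. v \<in> vars t \<Longrightarrow> \<rho> v = \<rho>' v) \<Longrightarrow> ev \<rho> t = ev \<rho>' t"
  by (induction t) simp_all

lemma ev_upd_other [simp]: "v \<notin> vars t \<Longrightarrow> ev (\<rho>(v := p)) t = ev \<rho> t"
  by (rule ev_cong) auto

primrec only :: "'a \<Rightarrow> 'a trm \<Rightarrow> bool" where
  "only a Zero \<longleftrightarrow> True"
| "only a (Var x) \<longleftrightarrow> False"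
| "only a (Pre \<mu> t) \<longleftrightarrow> \<mu> = Vis (Name a) \<and> only a t"
| "only a (t \<oplus> u) \<longleftrightarrow> only a t \<and> only a u"
| "only a (t \<parallel> u) \<longleftrightarrow> only a t \<and> only a u"

lemma only_closed: "only a t \<Longrightarrow> closed t"
  by (induction t) (simp_all add: closed_def)

text \<open>Rule \<open>comm\<close> never applies: it needs a label and its complement, while every
  step here carries \<open>Name a\<close>.\<close>

lemma step_only:
  "step p \<mu> p' \<Longrightarrow> only a p \<Longrightarrow> \<mu> = Vis (Name a) \<and> only a p' \<and> ev \<rho> p' \<in> ch (ev \<rho> p)"
  by (induction rule: step.induct) (auto simp: hpar_left hpar_right)

lemma ev_step:
  "only a p \<Longrightarrow> q \<in> ch (ev \<rho> p) \<Longrightarrow> \<exists>p'. step p (Vis (Name a)) p' \<and> ev \<rho> p' = q"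
proof (induction p arbitrary: q)
  case (Par t u)
  from Par.prems(2) have "q \<in> ch (ev \<rho> t \<bowtie> ev \<rho> u)" by simp
  then show ?case
  proof (cases rule: hpar_cases)
    case (1 p')
    then show ?thesis using Par.IH(1)[of p'] Par.prems(1) by (auto intro: step.intros)
  next
    case (2 p')
    then show ?thesis using Par.IH(2)[of p'] Par.prems(1) by (auto intro: step.intros)
  qed
next
  case (Plus t u)
  then show ?case by simp (metis step.plus_left step.plus_right)
qed (auto intro: step.intros)

lemma eps_only: "only a p \<Longrightarrow> eps p q \<Longrightarrow> q = p"
  unfolding eps_def by (erule converse_rtranclpE) (auto dest: step_only)

lemma weak_step_strict_only: "only a p \<Longrightarrow> weak_step_strict p \<mu> q \<Longrightarrow> step p \<mu> q"
  unfolding weak_step_strict_def by (metis eps_only step_only)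

lemma WB_sym: "WB p q \<Longrightarrow> WB q p"
  using weak_bisimulation_WB unfolding weak_bisimulation_def by (blast dest: sympD)

lemma WB_step_only:
  assumes "WB p q" "step p (Vis \<alpha>) p'" "only a q"
  obtains q' where "step q (Vis \<alpha>) q'" "WB p' q'"
proof -
  have "(Vis \<alpha> = Tau \<and> WB p' q) \<or> (\<exists>q'. weak_step q (Vis \<alpha>) q' \<and> WB p' q')"
    using weak_bisimulation_WB assms(1,2) unfolding weak_bisimulation_def by blast
  then obtain q' where "weak_step_strict q (Vis \<alpha>) q'" "WB p' q'"
    by (auto simp: weak_step_def)
  then show thesis
    using that weak_step_strict_only[OF assms(3)] by blast
qed

lemma matching_ev_subset:
  assumes "only a p" "only a q"
    and match: "\<And>\<mu> p'. step p \<mu> p' \<Longrightarrow> \<exists>q'. step q \<mu> q' \<and> ev \<rho> p' = ev \<rho> q'"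
  shows "ch (ev \<rho> p) \<subseteq> ch (ev \<rho> q)"
proof
  fix r assume "r \<in> ch (ev \<rho> p)"
  then obtain p' where p': "step p (Vis (Name a)) p'" "ev \<rho> p' = r"
    using ev_step[OF assms(1)] by blast
  then obtain q' where "step q (Vis (Name a)) q'" "r = ev \<rho> q'"
    using match by blast
  then show "r \<in> ch (ev \<rho> q)"
    using step_only[OF _ assms(2)] by blast
qed

text \<open>Without silent steps the matching is strong, so induction on depth identifies the values
  of derivatives.\<close>

lemma WB_ev_eq:
  assumes "WB p q" "only a p" "only a q"
  shows "ev \<rho> p = ev \<rho> q"
  using assms
proof (induction "depth (ev \<rho> p) + depth (ev \<rho> q)" arbitrary: p q rule: less_induct)
  case less
  \<comment> \<open>One direction, with the induction hypothesis as a premise so that the roles of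
    \<open>p\<close> and \<open>q\<close> can be exchanged.\<close>
  have *: "\<exists>q'. step q \<mu> q' \<and> ev \<rho> p' = ev \<rho> q'"
    if pq: "WB p q" "only a p" "only a q" "step p \<mu> p'"
      and IH: "\<And>p' q'. depth (ev \<rho> p') + depth (ev \<rho> q') < depth (ev \<rho> p) + depth (ev \<rho> q) \<Longrightarrow>
        WB p' q' \<Longrightarrow> only a p' \<Longrightarrow> only a q' \<Longrightarrow> ev \<rho> p' = ev \<rho> q'"
    for p q p' :: "'a trm" and \<mu>
  proof -
    have p': "\<mu> = Vis (Name a)" "only a p'" "ev \<rho> p' \<in> ch (ev \<rho> p)"
      using step_only[OF pq(4,2)] by auto
    obtain q' where q': "step q \<mu> q'" "WB p' q'"
      using WB_step_only[OF pq(1) _ pq(3)] pq(4) p'(1) by blast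
    have "only a q'" "ev \<rho> q' \<in> ch (ev \<rho> q)"
      using step_only[OF q'(1) pq(3)] by auto
    then have "ev \<rho> p' = ev \<rho> q'"
      using p' q' by (intro IH) (auto intro: add_strict_mono depth_less)
    then show ?thesis using q' by blast
  qed
  have "ch (ev \<rho> p) \<subseteq> ch (ev \<rho> q)"
    by (rule matching_ev_subset[OF less.prems(2,3)], rule *[OF less.prems], assumption)
      (rule less.hyps)
  moreover have "ch (ev \<rho> q) \<subseteq> ch (ev \<rho> p)"
    by (rule matching_ev_subset[OF less.prems(3,2)],
        rule *[OF WB_sym[OF less.prems(1)] less.prems(3,2)], assumption)
      (rule less.hyps, simp_all)
  ultimately have "ch (ev \<rho> p) = ch (ev \<rho> q)" by (rule subset_antisym)
  then show ?case by simp
qed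

lemma RWB_ev_eq:
  assumes "RWB p q" "only a p" "only a q"
  shows "ev \<rho> p = ev \<rho> q"
proof -
  have "\<exists>q'. step q \<mu> q' \<and> ev \<rho> p' = ev \<rho> q'" if s: "step p \<mu> p'" for \<mu> p'
  proof -
    obtain q' where q': "step q \<mu> q'" "WB p' q'"
      using assms(1) s weak_step_strict_only[OF assms(3)] unfolding RWB_def by blast
    then show ?thesis
      using WB_ev_eq[OF q'(2)] step_only[OF s assms(2)] step_only[OF q'(1) assms(3)] by blast
  qed
  moreover have "\<exists>p'. step p \<mu> p' \<and> ev \<rho> q' = ev \<rho> p'" if s: "step q \<mu> q'" for \<mu> q'
  proof -
    obtain p' where p': "step p \<mu> p'" "WB p' q'"
      using assms(1) s weak_step_strict_only[OF assms(2)] unfolding RWB_def by blast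
    then show ?thesis
      using WB_ev_eq[OF WB_sym[OF p'(2)]] step_only[OF s assms(3)] step_only[OF p'(1) assms(2)]
      by blast
  qed
  ultimately have "ch (ev \<rho> p) = ch (ev \<rho> q)"
    using matching_ev_subset[OF assms(2,3)] matching_ev_subset[OF assms(3,2)]
    by (intro subset_antisym) blast+
  then show ?thesis by simp
qed

lemma ev_surj: "\<exists>t. only a t \<and> ev \<rho> t = p"
proof (induction p rule: hf_induct)
  case (node p)
  have "\<exists>t. only a t \<and> ch (ev \<rho> t) = A" if "A \<subseteq> ch p" "finite A" for A
    using that(2,1)
  proof (induction rule: finite_induct)
    case empty
    show ?case by (rule exI[of _ Zero]) simp
  next
    case (insert q A)
    then obtain t where "only a t" "ch (ev \<rho> t) = A" by auto
    moreover obtain s where "only a s" "ev \<rho> s = q" using node insert.prems by auto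
    ultimately show ?case by (intro exI[of _ "Pre (Vis (Name a)) s \<oplus> t"]) simp
  qed
  from this[of "ch p"] show ?case by simp
qed

section \<open>Prefix-free terms and soundness\<close>

primrec prefix_free :: "'a trm \<Rightarrow> bool" where
  "prefix_free Zero \<longleftrightarrow> True"
| "prefix_free (Var x) \<longleftrightarrow> True"
| "prefix_free (Pre \<mu> t) \<longleftrightarrow> False"
| "prefix_free (t \<oplus> u) \<longleftrightarrow> prefix_free t \<and> prefix_free u"
| "prefix_free (t \<parallel> u) \<longleftrightarrow> prefix_free t \<and> prefix_free u"

lemma prefix_free_subst:
  "prefix_free (subst \<sigma> t) \<longleftrightarrow> prefix_free t \<and> (\<forall>v\<in>vars t. prefix_free (\<sigma> v))"
  by (induction t) auto

text \<open>By \<open>ev_surj\<close> every valuation comes from a closed one-action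
  substitution.\<close>

lemma sound_eq_ev:
  assumes "sound_eq t u" "prefix_free t" "prefix_free u"
  shows "ev \<rho> t = ev \<rho> u"
proof -
  define a :: 'a where "a = undefined"
  obtain \<sigma> :: "var \<Rightarrow> 'a trm" where \<sigma>: "\<And>v. only a (\<sigma> v)" "\<And>v. ev (\<lambda>_. nil) (\<sigma> v) = \<rho> v"
  proof -
    have "\<forall>v. \<exists>t. only a t \<and> ev (\<lambda>_. nil) t = \<rho> v"
      by (intro allI ev_surj)
    then show thesis using that by (auto dest!: choice)
  qed
  have only: "only a (subst \<sigma> t)" if "prefix_free t" for t
    using that by (induction t) (simp_all add: \<sigma>)
  have "RWB (subst \<sigma> t) (subst \<sigma> u)"
    using assms(1) only_closed[OF \<sigma>(1)] by (simp add: sound_eq_def)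
  then have "ev (\<lambda>_. nil) (subst \<sigma> t) = ev (\<lambda>_. nil) (subst \<sigma> u)"
    by (rule RWB_ev_eq[OF _ only[OF assms(2)] only[OF assms(3)]])
  then show ?thesis by (simp add: ev_subst \<sigma>)
qed

lemma prefix_free_iff_stuck:
  "prefix_free t \<longleftrightarrow> (\<forall>\<mu> p. \<not> step (subst (\<lambda>_. Zero) t) \<mu> p)"
proof -
  have "\<not> prefix_free t" if "step s \<mu> p" "s = subst (\<lambda>_. Zero) t" for s \<mu> p
    using that
  proof (induction arbitrary: t rule: step.induct)
    case (prefix \<mu> p)
    then show ?case by (cases t) simp_all
  next
    case (plus_left p \<mu> p' q)
    then show ?case by (cases t) simp_all
  next
    case (plus_right p \<mu> p' q)
    then show ?case by (cases t) simp_all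
  next
    case (par_left p \<mu> p' q)
    then show ?case by (cases t) simp_all
  next
    case (par_right p \<mu> p' q)
    then show ?case by (cases t) simp_all
  next
    case (comm p \<alpha> p' q q')
    then show ?case by (cases t) simp_all
  qed
  moreover have "\<exists>\<mu> p. step (subst (\<lambda>_. Zero) t) \<mu> p" if "\<not> prefix_free t"
    using that by (induction t) (auto intro: step.intros)
  ultimately show ?thesis by blast
qed

text \<open>The root condition enters here: even a silent first move needs an actual move as answer,
  so stuck processes are related to stuck ones only.\<close>

lemma sound_eq_prefix_free:
  assumes "sound_eq t u"
  shows "prefix_free t \<longleftrightarrow> prefix_free u"
proof -
  have first: "\<exists>\<nu> q'. step p \<nu> q'" if "weak_step_strict p \<mu> q" for p q :: "'a trm" and \<mu>
    using that unfolding weak_step_strict_def eps_def by (metis converse_rtranclpE)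
  have "RWB (subst (\<lambda>_. Zero) t) (subst (\<lambda>_. Zero) u)"
    using assms by (simp add: sound_eq_def closed_def)
  then show ?thesis
    unfolding RWB_def prefix_free_iff_stuck using first by metis
qed

lemma ev_eq_nil: "prefix_free t \<Longrightarrow> ev \<rho> t = nil \<longleftrightarrow> (\<forall>v\<in>vars t. \<rho> v = nil)"
  by (induction t) auto

lemma depth_var: "prefix_free t \<Longrightarrow> v \<in> vars t \<Longrightarrow> depth (\<rho> v) \<le> depth (ev \<rho> t)"
  by (induction t) auto

section \<open>Summands\<close>

text \<open>Parallel components with value \<^const>\<open>nil\<close> are skipped, so that
  \<^term>\<open>t \<parallel> Zero\<close> has the summands of \<^term>\<open>t\<close>.\<close>

primrec summands :: "(var \<Rightarrow> hf) \<Rightarrow> 'a trm \<Rightarrow> 'a trm set" where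
  "summands \<rho> Zero = {}"
| "summands \<rho> (Var x) = {Var x}"
| "summands \<rho> (Pre \<mu> t) = {Pre \<mu> t}"
| "summands \<rho> (t \<oplus> u) = summands \<rho> t \<union> summands \<rho> u"
| "summands \<rho> (t \<parallel> u) =
     (if ev \<rho> t = nil then summands \<rho> u else if ev \<rho> u = nil then summands \<rho> t else {t \<parallel> u})"

lemma ev_summands: "ch (ev \<rho> t) = (\<Union>s\<in>summands \<rho> t. ch (ev \<rho> s))"
  by (induction t) auto

lemma summand_ev_subset: "s \<in> summands \<rho> t \<Longrightarrow> ch (ev \<rho> s) \<subseteq> ch (ev \<rho> t)"
  by (subst (2) ev_summands) blast

lemma summand_depth: "s \<in> summands \<rho> t \<Longrightarrow> depth (ev \<rho>' s) \<le> depth (ev \<rho>' t)"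
  by (induction t) (auto split: if_splits)

lemma summand_prefix_free: "s \<in> summands \<rho> t \<Longrightarrow> prefix_free t \<Longrightarrow> prefix_free s"
  by (induction t) (auto split: if_splits)

lemma summand_size: "s \<in> summands \<rho> t \<Longrightarrow> size s \<le> size t"
  by (induction t) (auto split: if_splits)

lemma summand_par_nonnil: "p \<parallel> q \<in> summands \<rho> t \<Longrightarrow> ev \<rho> p \<noteq> nil \<and> ev \<rho> q \<noteq> nil"
  by (induction t) (auto split: if_splits)

lemma finite_summands [simp]: "finite (summands \<rho> t)"
  by (induction t) auto

lemma card_summands: "card (summands \<rho> t) \<le> Suc (size t)"
proof (induction t)
  case (Plus t u)
  then show ?case using card_Un_le[of "summands \<rho> t" "summands \<rho> u"] by simp
qed auto

text \<open>Probing replaces one non-nil value by another, and so keeps the summands.\<close>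

lemma summands_cong:
  "prefix_free t \<Longrightarrow> (\<And>v. \<rho> v = nil \<longleftrightarrow> \<rho>' v = nil) \<Longrightarrow> summands \<rho> t = summands \<rho>' t"
  by (induction t) (simp_all add: ev_eq_nil)

text \<open>The term has a summand with value \<open>w\<close>, where \<open>h\<close> tells which variables stand for terms
  that already have one; with this parameter the property commutes with substitution.\<close>

primrec has_summand :: "hf \<Rightarrow> (var \<Rightarrow> bool) \<Rightarrow> (var \<Rightarrow> hf) \<Rightarrow> 'a trm \<Rightarrow> bool" where
  "has_summand w h \<rho> Zero \<longleftrightarrow> False"
| "has_summand w h \<rho> (Var x) \<longleftrightarrow> h x"
| "has_summand w h \<rho> (Pre \<mu> t) \<longleftrightarrow> False"
| "has_summand w h \<rho> (t \<oplus> u) \<longleftrightarrow> has_summand w h \<rho> t \<or> has_summand w h \<rho> u"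
| "has_summand w h \<rho> (t \<parallel> u) \<longleftrightarrow>
     (if ev \<rho> t = nil then has_summand w h \<rho> u else if ev \<rho> u = nil then has_summand w h \<rho> t
      else ev \<rho> t \<bowtie> ev \<rho> u = w)"

lemma has_summand_subst:
  "has_summand w h \<rho> (subst \<sigma> t) = has_summand w (\<lambda>v. has_summand w h \<rho> (\<sigma> v)) (\<lambda>v. ev \<rho> (\<sigma> v)) t"
  by (induction t) (simp_all add: ev_subst)

lemma has_summand_subset:
  "has_summand w h \<rho> t \<Longrightarrow> (\<And>v. h v \<Longrightarrow> ch w \<subseteq> ch (\<rho> v)) \<Longrightarrow> ch w \<subseteq> ch (ev \<rho> t)"
  by (induction t) (auto split: if_splits)

lemma has_summand_iff:
  "has_summand w h \<rho> t \<longleftrightarrow> (\<exists>v. Var v \<in> summands \<rho> t \<and> h v) \<or>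
     (\<exists>p q. p \<parallel> q \<in> summands \<rho> t \<and> ev \<rho> p \<bowtie> ev \<rho> q = w)"
  by (induction t) auto

section \<open>Probing a variable with a deep irreducible process\<close>

text \<open>An occurrence of \<open>v\<close> steps to \<open>c\<close> while its parallel
  components stay idle; \<open>r\<close> collects these.\<close>

lemma probe_factor:
  "prefix_free t \<Longrightarrow> v \<in> vars t \<Longrightarrow> \<exists>r. r \<bowtie> c \<in> ch (ev (\<rho>(v := node {c})) t)"
proof (induction t)
  case (Var x)
  then show ?case by (auto intro: exI[of _ nil])
next
  case (Par t u)
  show ?case
  proof (cases "v \<in> vars t")
    case True
    then obtain r where "r \<bowtie> c \<in> ch (ev (\<rho>(v := node {c})) t)"
      using Par.IH(1) Par.prems(1) unfolding prefix_free.simps by blast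
    from hpar_left[OF this, of "ev (\<rho>(v := node {c})) u"] show ?thesis
      unfolding ev.simps hpar_right_commute[of r c] by blast
  next
    case False
    then have "v \<in> vars u" using Par.prems(2) by simp
    then obtain r where "r \<bowtie> c \<in> ch (ev (\<rho>(v := node {c})) u)"
      using Par.IH(2) Par.prems(1) unfolding prefix_free.simps by blast
    from hpar_right[OF this, of "ev (\<rho>(v := node {c})) t"] show ?thesis
      unfolding ev.simps hpar_assoc[symmetric] by blast
  qed
qed auto

text \<open>Either \<open>v\<close> moved and \<open>c\<close> became a factor, or no
  \<open>v\<close> is left and the depth is bounded with \<open>v\<close> worth \<open>nil\<close>,
  or a remaining \<open>v\<close> exposes \<open>c\<close> in the next step.\<close>

lemma probe_step:
  assumes "prefix_free t" "q \<in> ch (ev (\<rho>(v := node {c})) t)"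
  shows "(\<exists>r. q = r \<bowtie> c) \<or> depth q \<le> depth (ev (\<rho>(v := nil)) t) \<or> (\<exists>r. r \<bowtie> c \<in> ch q)"
  using assms
proof (induction t arbitrary: q)
  case (Var x)
  then show ?case
    by (cases "x = v") (auto intro: exI[of _ nil] dest: depth_less)
next
  case (Plus t u)
  from Plus.prems(2) consider "q \<in> ch (ev (\<rho>(v := node {c})) t)" | "q \<in> ch (ev (\<rho>(v := node {c})) u)"
    unfolding ev.simps ch_hplus by blast
  then show ?case
    using Plus.IH Plus.prems(1) unfolding ev.simps prefix_free.simps depth_hplus le_max_iff_disj
    by cases blast+
next
  case (Par t u)
  \<comment> \<open>The left component moves; a move of the right one reduces to this by
    commutativity.\<close>
  have *: "(\<exists>r. q \<bowtie> ev (\<rho>(v := node {c})) u = r \<bowtie> c) \<or>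
      depth (q \<bowtie> ev (\<rho>(v := node {c})) u) \<le> depth (ev (\<rho>(v := nil)) t) + depth (ev (\<rho>(v := nil)) u) \<or>
      (\<exists>r. r \<bowtie> c \<in> ch (q \<bowtie> ev (\<rho>(v := node {c})) u))"
    if u: "prefix_free u" and
      q: "(\<exists>r. q = r \<bowtie> c) \<or> depth q \<le> depth (ev (\<rho>(v := nil)) t) \<or> (\<exists>r. r \<bowtie> c \<in> ch q)"
    for t u :: "'a trm" and q
    using q
  proof (elim disjE exE)
    fix r assume "q = r \<bowtie> c"
    then have "q \<bowtie> ev (\<rho>(v := node {c})) u = (r \<bowtie> ev (\<rho>(v := node {c})) u) \<bowtie> c"
      by (simp only: hpar_right_commute)
    then show ?thesis by blast
  next
    fix r assume "r \<bowtie> c \<in> ch q"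
    from hpar_left[OF this, of "ev (\<rho>(v := node {c})) u"]
    have "(r \<bowtie> ev (\<rho>(v := node {c})) u) \<bowtie> c \<in> ch (q \<bowtie> ev (\<rho>(v := node {c})) u)"
      by (simp only: hpar_right_commute[of r c])
    then show ?thesis by blast
  next
    assume d: "depth q \<le> depth (ev (\<rho>(v := nil)) t)"
    show ?thesis
    proof (cases "v \<in> vars u")
      case True
      then obtain r where "r \<bowtie> c \<in> ch (ev (\<rho>(v := node {c})) u)"
        using probe_factor[OF u] by blast
      from hpar_right[OF this, of q]
      have "(q \<bowtie> r) \<bowtie> c \<in> ch (q \<bowtie> ev (\<rho>(v := node {c})) u)"
        by (simp only: hpar_assoc)
      then show ?thesis by blast
    next
      case False
      then show ?thesis using d by simp
    qed
  qed
  have pf: "prefix_free t" "prefix_free u" using Par.prems(1) by simp_all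
  from Par.prems(2) have "q \<in> ch (ev (\<rho>(v := node {c})) t \<bowtie> ev (\<rho>(v := node {c})) u)"
    unfolding ev.simps .
  then show ?case
  proof (cases rule: hpar_cases)
    case (1 p')
    show ?thesis
      unfolding 1(2) ev.simps depth_hpar[of "ev (\<rho>(v := nil)) t"]
      by (rule *[OF pf(2) Par.IH(1)[OF pf(1) 1(1)]])
  next
    case (2 p')
    show ?thesis
      unfolding 2(2) ev.simps depth_hpar[of "ev (\<rho>(v := nil)) t"] hpar_commute[of _ p']
        add.commute[of "depth (ev (\<rho>(v := nil)) t)"]
      by (rule *[OF pf(1) Par.IH(2)[OF pf(2) 2(1)]])
  qed
qed auto

text \<open>A product of non-nil components steps to the irreducible \<open>cc g\<close> only if one
  component vanishes and the other is worth \<open>cc g\<close>. But a component containing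
  \<open>v\<close> is deeper than \<open>g\<close>, and any other is shallower.\<close>

lemma probe_var_summand:
  assumes "prefix_free t" "\<rho> v \<noteq> nil" "depth (ev (\<rho>(v := nil)) t) < g"
    and "cc g \<in> ch (ev (\<rho>(v := node {cc g})) t)"
  shows "Var v \<in> summands \<rho> t"
  using assms
proof (induction t)
  case (Var x)
  then show ?case by (auto split: if_splits dest: depth_less)
next
  case (Par t u)
  let ?\<rho> = "\<rho>(v := node {cc g})"
  have nonnil: "ev ?\<rho> s = nil \<longleftrightarrow> ev \<rho> s = nil" if "prefix_free s" for s :: "'a trm"
    using ev_eq_nil[OF that] Par.prems(2)
    by (auto simp flip: ch_eq_empty split: if_splits)
  have no: "cc g \<noteq> ev ?\<rho> s"
    if s: "prefix_free s" "depth (ev (\<rho>(v := nil)) s) < g" for s :: "'a trm"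
  proof
    assume eq: "cc g = ev ?\<rho> s"
    show False
    proof (cases "v \<in> vars s")
      case True
      have "g < depth (node {cc g})" using depth_less[of "cc g" "node {cc g}"] by simp
      also have "\<dots> \<le> depth (ev ?\<rho> s)" using depth_var[OF s(1) True, of ?\<rho>] by simp
      finally show False by (simp flip: eq)
    next
      case False
      then have "depth (ev ?\<rho> s) < g" using s(2) by simp
      then show False by (simp flip: eq)
    qed
  qed
  have pf: "prefix_free t" "prefix_free u" using Par.prems(1) by auto
  have d: "depth (ev (\<rho>(v := nil)) t) < g" "depth (ev (\<rho>(v := nil)) u) < g"
    using Par.prems(3) unfolding ev.simps depth_hpar by linarith+
  consider "ev \<rho> t = nil" | "ev \<rho> t \<noteq> nil" "ev \<rho> u = nil" | "ev \<rho> t \<noteq> nil" "ev \<rho> u \<noteq> nil"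
    by blast
  then show ?case
  proof cases
    case 1
    then show ?thesis using Par pf d nonnil[OF pf(1)] by (simp del: fun_upd_apply)
  next
    case 2
    then show ?thesis using Par pf d nonnil[OF pf(2)] by (simp del: fun_upd_apply)
  next
    case 3
    have g: "nil \<in> ch (cc g)" using Par.prems(3) by simp
    have "cc g \<in> ch (ev ?\<rho> t \<bowtie> ev ?\<rho> u)"
      using Par.prems(4) unfolding ev.simps .
    then have False
    proof (cases rule: hpar_cases)
      case (1 p')
      then show False
        using irreducible[OF 1(2)[symmetric] g] no[OF pf(2) d(2)] 3 nonnil[OF pf(2)] by auto
    next
      case (2 p')
      then show False
        using irreducible[OF 2(2)[symmetric] g] no[OF pf(1) d(1)] 3 nonnil[OF pf(1)] by auto
    qed
    then show ?thesis ..
  qed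
qed auto

text \<open>The factor \<open>cc g\<close> can step to \<open>cc (g - 1)\<close>. By
  \<open>probe_step\<close> the residual is then shallow, or it or one of its derivatives has the
  factor \<open>cc g\<close>; depth and \<open>cc_not_factor\<close> exclude this.\<close>

lemma probe_not_product:
  assumes t: "prefix_free t" and a: "nil \<in> ch a" "\<And>f. f \<in> ch a \<Longrightarrow> f = nil \<or> nil \<in> ch f"
    and g: "depth (ev (\<rho>(v := nil)) t) + depth a + 3 < g"
  shows "ev (\<rho>(v := node {cc g})) t \<noteq> a \<bowtie> cc g"
proof
  assume eq: "ev (\<rho>(v := node {cc g})) t = a \<bowtie> cc g"
  \<comment> \<open>Two steps down from \<open>cc g\<close> are examined, and
    \<open>cc_not_factor\<close> needs both results to be non-nil.\<close>
  obtain k where k: "g = Suc (Suc k)" "0 < k"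
    using g by (intro that[of "g - 2"]) auto
  have "a \<bowtie> cc (Suc k) \<in> ch (ev (\<rho>(v := node {cc g})) t)"
    unfolding eq by (rule hpar_right) (simp add: k(1))
  from probe_step[OF t this] show False
  proof (elim disjE exE)
    fix r assume "a \<bowtie> cc (Suc k) = r \<bowtie> cc g"
    then show False using a g k by (intro cc_not_factor[of a "Suc k" r g]) auto
  next
    assume "depth (a \<bowtie> cc (Suc k)) \<le> depth (ev (\<rho>(v := nil)) t)"
    then show False using g k by simp
  next
    fix r assume "r \<bowtie> cc g \<in> ch (a \<bowtie> cc (Suc k))"
    then show False
    proof (cases rule: hpar_cases)
      case (1 f)
      have "f = nil \<or> nil \<in> ch f" "depth f < depth a" using 1 a depth_less by blast+
      then show False using 1 g k by (intro cc_not_factor[of f "Suc k" r g]) auto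
    next
      case (2 c)
      then consider "c = nil" | "c = cc k" by auto
      then show False
      proof cases
        case 1
        then have "depth (r \<bowtie> cc g) = depth a" using 2 by simp
        then show False using g by simp
      next
        case c: 2
        then show False using 2 a g k by (intro cc_not_factor[of a k r g]) auto
      qed
    qed
  qed
qed

section \<open>The invariant of derivations\<close>

lemma ch_cc: "0 < k \<Longrightarrow> ch (cc k) = {nil, cc (k - 1)}"
  by (cases k) auto

text \<open>The values are \<open>x = cc 2\<close>, \<open>y = cc 3\<close> and \<open>z\<^sub>i = cc (2 * i + 4)\<close>. The spacing keeps the
  steps \<open>cc (2 * i + 3)\<close> of the \<open>z\<^sub>i\<close> apart from the \<open>z\<^sub>i\<close> themselves and from the steps of
  \<open>x + y\<close>.\<close>

definition xy :: hf where
  "xy = hplus (cc 2) (cc 3)"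

definition zz :: "nat \<Rightarrow> hf" where
  "zz n = node (insert nil ((\<lambda>i. cc (2 * i + 3)) ` {1..n}))"

lemma ch_xy: "ch xy = {nil, cc 1, cc 2}"
  by (auto simp: xy_def ch_cc)

lemma nil_in_xy: "nil \<in> ch xy"
  by (simp add: ch_xy)

lemma xy_elements: "f \<in> ch xy \<Longrightarrow> f = nil \<or> nil \<in> ch f"
  by (auto simp: ch_xy)

lemma depth_xy [simp]: "depth xy = 3"
  by (simp add: xy_def)

lemma ch_zz: "ch (zz n) = insert nil ((\<lambda>i. cc (2 * i + 3)) ` {1..n})"
  by (simp add: zz_def)

lemma zz_neq_cc:
  assumes "2 \<le> n"
  shows "zz n \<noteq> cc k"
proof
  assume eq: "zz n = cc k"
  have "cc (2 * 1 + 3) \<in> ch (zz n)" "cc (2 * 2 + 3) \<in> ch (zz n)"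
    using assms unfolding ch_zz by force+
  then show False unfolding eq by (cases k) (auto simp: ch_cc)
qed

lemma zz_neq_nil: "2 \<le> n \<Longrightarrow> zz n \<noteq> nil"
  using zz_neq_cc[of n 0] by simp

lemma xy_neq_cc: "xy \<noteq> cc k"
proof
  assume "xy = cc k"
  then have "ch (cc k) = {nil, cc 1, cc 2}" using ch_xy by simp
  then have "cc 1 \<in> ch (cc k)" "cc 2 \<in> ch (cc k)" by auto
  then show False by (cases k) auto
qed

lemma xy_neq_zz: "xy \<noteq> zz n" if "2 \<le> n"
proof
  assume "xy = zz n"
  moreover have "cc (2 * 1 + 3) \<in> ch (zz n)" using that unfolding ch_zz by force
  ultimately show False by (simp add: ch_xy)
qed

text \<open>A step of \<open>p\<close> leaves the non-nil \<open>q\<close>, so its result is some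
  irreducible \<open>cc (2 * i + 3)\<close>, equal to \<open>q\<close>, and \<open>p\<close> steps
  to \<open>nil\<close> only. By symmetry \<open>p\<close> is such a \<open>cc\<close> too, which
  has a non-nil step.\<close>

lemma product_not_subset_zz:
  assumes "p \<noteq> nil" "q \<noteq> nil"
  shows "\<not> ch (p \<bowtie> q) \<subseteq> ch (zz n)"
proof
  assume sub: "ch (p \<bowtie> q) \<subseteq> ch (zz n)"
  have *: "ch p = {nil} \<and> (\<exists>i. q = cc (2 * i + 3))"
    if "p \<noteq> nil" "q \<noteq> nil" and sub: "ch (p \<bowtie> q) \<subseteq> ch (zz n)" for p q
  proof -
    have 1: "p' = nil \<and> (\<exists>i. q = cc (2 * i + 3))" if p': "p' \<in> ch p" for p'
    proof -
      obtain i where "p' \<bowtie> q = cc (2 * i + 3)"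
        using sub hpar_left[OF p', of q] \<open>q \<noteq> nil\<close> unfolding ch_zz by auto
      then show ?thesis using irreducible[of p' q "cc (2 * i + 3)"] \<open>q \<noteq> nil\<close> by auto
    qed
    then show ?thesis using \<open>p \<noteq> nil\<close> ch_eq_empty by blast
  qed
  obtain i where "p = cc (2 * i + 3)"
    using *[of q p] assms sub hpar_commute[of p q] by auto
  moreover have "ch p = {nil}" using *[of p q] assms sub by auto
  ultimately show False by (simp add: ch_cc)
qed

text \<open>Summands with the critical value are not preserved by all sound axioms: an instance of
  \<open>M\<^sub>2\<close> may lose one. They are preserved in the processes below \<open>M\<^sub>n\<close>, of which the argument
  needs only the following property.\<close>

definition good :: "nat \<Rightarrow> hf \<Rightarrow> bool" where
  "good n p \<longleftrightarrow> (\<forall>q\<in>ch p. \<forall>i\<in>{1..n}. \<forall>j\<in>{1..n}. i \<noteq> j \<longrightarrow>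
     cc (2 * i + 3) \<in> ch q \<longrightarrow> cc (2 * j + 3) \<in> ch q \<longrightarrow> q = zz n)"

lemma good_hplus: "good n (hplus p q) \<longleftrightarrow> good n p \<and> good n q"
  unfolding good_def ch_hplus by blast

lemma summand_var_or_par:
  assumes "s \<in> summands \<rho> t" "prefix_free t"
  obtains v where "s = Var v" | p q where "s = p \<parallel> q"
proof -
  have "(\<exists>v. s = Var v) \<or> (\<exists>p q. s = p \<parallel> q)"
    using assms by (induction t) (auto split: if_splits)
  then show thesis using that by blast
qed

lemma sound_eq_par_summand:
  assumes snd: "sound_eq t u" and pf: "prefix_free t" "prefix_free u"
    and n: "2 \<le> n" "Suc (size t) < n" and good: "good n (ev \<rho> t)"
    and pq: "p \<parallel> q \<in> summands \<rho> t \<or> q \<parallel> p \<in> summands \<rho> t" "ev \<rho> p = xy" "ev \<rho> q = zz n"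
  shows "\<exists>a b. a \<parallel> b \<in> summands \<rho> u \<and> ev \<rho> a \<bowtie> ev \<rho> b = xy \<bowtie> zz n"
proof -
  have pf_q: "prefix_free p" "prefix_free q"
    using pq(1) pf(1) summand_prefix_free by fastforce+
  have card: "card (summands \<rho> q) < n"
    using card_summands[of \<rho> q] pq(1) n(2) summand_size by fastforce
  \<comment> \<open>Parallel summands of \<open>q\<close> are excluded by
    \<open>product_not_subset_zz\<close>, so its steps come from variables.\<close>
  have "\<forall>i\<in>{1..n}. \<exists>v. Var v \<in> summands \<rho> q \<and> cc (2 * i + 3) \<in> ch (\<rho> v)"
  proof
    fix i assume "i \<in> {1..n}"
    then have "cc (2 * i + 3) \<in> ch (ev \<rho> q)" unfolding pq(3) ch_zz by blast
    then obtain s where s: "s \<in> summands \<rho> q" "cc (2 * i + 3) \<in> ch (ev \<rho> s)"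
      using ev_summands[of \<rho> q] by blast
    from s(1) pf_q(2) show "\<exists>v. Var v \<in> summands \<rho> q \<and> cc (2 * i + 3) \<in> ch (\<rho> v)"
    proof (cases rule: summand_var_or_par)
      case (1 v)
      then show ?thesis using s by auto
    next
      case (2 a b)
      then have "ch (ev \<rho> a \<bowtie> ev \<rho> b) \<subseteq> ch (zz n)"
        using summand_ev_subset[OF s(1)] pq(3) by simp
      then show ?thesis
        using product_not_subset_zz summand_par_nonnil s(1) 2 by blast
    qed
  qed
  then obtain w where w: "\<And>i. i \<in> {1..n} \<Longrightarrow> Var (w i) \<in> summands \<rho> q"
    "\<And>i. i \<in> {1..n} \<Longrightarrow> cc (2 * i + 3) \<in> ch (\<rho> (w i))"
    by metis
  have "card ((\<lambda>i. Var (w i) :: 'a trm) ` {1..n}) \<le> card (summands \<rho> q)"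
    using w(1) by (intro card_mono) auto
  then have "\<not> inj_on (\<lambda>i. Var (w i) :: 'a trm) {1..n}"
    using card by (intro pigeonhole) simp
  then obtain i j where ij: "i \<in> {1..n}" "j \<in> {1..n}" "i \<noteq> j" "w i = w j"
    by (auto simp: inj_on_def)
  define v where "v = w i"
  have v: "Var v \<in> summands \<rho> q" "cc (2 * i + 3) \<in> ch (\<rho> v)" "cc (2 * j + 3) \<in> ch (\<rho> v)"
    using w[OF ij(1)] w(2)[OF ij(2)] ij(4) unfolding v_def by simp_all
  have depth_v: "3 < depth (\<rho> v)" using depth_less[OF v(2)] by simp
  then have v_nonnil: "\<rho> v \<noteq> nil" by auto
  have v_p: "v \<notin> vars p"
    using depth_var[OF pf_q(1), of v \<rho>] depth_v pq(2) by auto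

  \<comment> \<open>This exceeds the depth of \<open>u\<close> both under \<open>\<rho>\<close> and
    with \<open>v\<close> worth \<open>nil\<close>; the slack covers \<open>xy\<close> in
    \<open>probe_not_product\<close>.\<close>
  define g where "g = depth (ev (\<rho>(v := nil)) u) + depth (ev \<rho> u) + 10"
  define \<rho>' where "\<rho>' = \<rho>(v := node {cc g})"
  have node_g: "ch (\<rho>' v) = {cc g}" by (simp add: \<rho>'_def)
  have nil_iff: "\<rho>' x = nil \<longleftrightarrow> \<rho> x = nil" for x
    using v_nonnil node_g by (cases "x = v") (auto simp: \<rho>'_def simp flip: ch_eq_empty)
  have summands': "summands \<rho>' s = summands \<rho> s" if "prefix_free s" for s :: "'a trm"
    using that nil_iff by (intro summands_cong)
  have "ev \<rho>' p = xy" using v_p pq(2) by (simp add: \<rho>'_def)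
  moreover have "cc g \<in> ch (ev \<rho>' q)"
    using summand_ev_subset[of "Var v" \<rho>' q] v(1) summands'[OF pf_q(2)] node_g by auto
  ultimately have "xy \<bowtie> cc g \<in> ch (ev \<rho>' p \<bowtie> ev \<rho>' q)" using hpar_right by simp
  then have "xy \<bowtie> cc g \<in> ch (ev \<rho>' t)"
    using pq(1) summand_ev_subset[of "p \<parallel> q" \<rho>' t] summand_ev_subset[of "q \<parallel> p" \<rho>' t]
      summands'[OF pf(1)] hpar_commute[of "ev \<rho>' q"] by auto
  then have "xy \<bowtie> cc g \<in> ch (ev \<rho>' u)"
    using sound_eq_ev[OF snd pf] by metis
  then obtain s where s: "s \<in> summands \<rho> u" "xy \<bowtie> cc g \<in> ch (ev \<rho>' s)"
    using ev_summands[of \<rho>' u] summands'[OF pf(2)] by auto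

  \<comment> \<open>Once \<open>a' = nil\<close> is refuted, \<open>a'\<close> and
    \<open>ev \<rho>' b\<close> are \<open>xy\<close> and \<open>cc g\<close> in some order. For
    \<open>b\<close> to be worth \<open>cc g\<close> is impossible: it is too deep with
    \<open>v\<close> and too shallow without.\<close>
  have claim: "ev \<rho> b = xy \<and> Var v \<in> summands \<rho> a"
    if ab: "a \<parallel> b \<in> summands \<rho> u \<or> b \<parallel> a \<in> summands \<rho> u"
      and a': "a' \<in> ch (ev \<rho>' a)" "xy \<bowtie> cc g = a' \<bowtie> ev \<rho>' b" for a b a'
  proof -
    have pf_ab: "prefix_free a" "prefix_free b"
      using ab pf(2) summand_prefix_free by fastforce+
    have d: "depth (ev \<sigma> a) + depth (ev \<sigma> b) \<le> depth (ev \<sigma> u)" for \<sigma>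
      using ab summand_depth[of "a \<parallel> b" \<rho> u \<sigma>] summand_depth[of "b \<parallel> a" \<rho> u \<sigma>] by auto
    have small: "ev \<rho>' b = ev \<rho> b" if "v \<notin> vars b"
      using that by (simp add: \<rho>'_def)
    have big: "g < depth (ev \<rho>' b)" if "v \<in> vars b"
      using depth_less[of "cc g" "\<rho>' v"] depth_var[OF pf_ab(2) that, of \<rho>'] node_g by simp
    have "ev \<rho>' b \<noteq> nil"
      using ab summand_par_nonnil[of _ _ \<rho>' u] summands'[OF pf(2)] by blast
    moreover have "a' \<noteq> nil"
    proof
      assume "a' = nil"
      then have "ev (\<rho>(v := node {cc g})) b = xy \<bowtie> cc g" using a'(2) by (simp add: \<rho>'_def)
      moreover have "depth (ev (\<rho>(v := nil)) b) + depth xy + 3 < g"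
        using d[of "\<rho>(v := nil)"] unfolding g_def depth_xy by linarith
      ultimately show False
        using probe_not_product[OF pf_ab(2) nil_in_xy xy_elements, of \<rho> v g] by blast
    qed
    moreover have "nil \<in> ch (cc g)" by (simp add: g_def)
    ultimately consider "a' = xy" "ev \<rho>' b = cc g" | "a' = cc g" "ev \<rho>' b = xy"
      using two_factors[OF a'(2)[symmetric]] xy_neq_cc by (auto simp: ch_xy)
    then show ?thesis
    proof cases
      case 1
      then have "depth (ev \<rho>' b) = g" by simp
      then show ?thesis using big small d[of \<rho>] unfolding g_def by fastforce
    next
      case 2
      then have "v \<notin> vars b" using big unfolding g_def by auto
      then have "ev \<rho> b = xy" using 2 small by simp
      moreover have "Var v \<in> summands \<rho> a"
      proof (rule probe_var_summand[of a \<rho> v g, OF pf_ab(1) v_nonnil])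
        show "depth (ev (\<rho>(v := nil)) a) < g"
          using d[of "\<rho>(v := nil)"] unfolding g_def by linarith
        show "cc g \<in> ch (ev (\<rho>(v := node {cc g})) a)"
          using a'(1) 2(1) unfolding \<rho>'_def by blast
      qed
      ultimately show ?thesis ..
    qed
  qed
  obtain a b where ab: "a \<parallel> b \<in> summands \<rho> u \<or> b \<parallel> a \<in> summands \<rho> u"
    "ev \<rho> b = xy" "Var v \<in> summands \<rho> a"
    using s(1) pf(2)
  proof (cases rule: summand_var_or_par)
    case (1 x)
    show thesis
    proof (cases "x = v")
      case True
      then have "xy \<bowtie> cc g = cc g" using s(2) 1 node_g by simp
      then have "depth (xy \<bowtie> cc g) = depth (cc g)" by simp
      then show thesis by simp
    next
      case False
      then have "depth (xy \<bowtie> cc g) < depth (ev \<rho> s)" using s(2) 1 by (auto simp: \<rho>'_def dest: depth_less)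
      also have "\<dots> \<le> depth (ev \<rho> u)" using summand_depth[OF s(1)] .
      finally show thesis by (simp add: g_def)
    qed
  next
    case (2 a b)
    have "xy \<bowtie> cc g \<in> ch (ev \<rho>' a \<bowtie> ev \<rho>' b)" using s(2) 2 by simp
    then show thesis
    proof (cases rule: hpar_cases)
      case (1 a')
      then show thesis using claim[of a b a'] s(1) 2 that by blast
    next
      case (2 b')
      have "xy \<bowtie> cc g = b' \<bowtie> ev \<rho>' a" using 2(2) hpar_commute by simp
      then show thesis using claim[of b a b'] s(1) \<open>s = a \<parallel> b\<close> 2(1) that by blast
    qed
  qed
  \<comment> \<open>Since \<open>xy\<close> can vanish, \<open>ev \<rho> a\<close> is a step of
    \<open>ev \<rho> u\<close>. Through \<open>v\<close> it has the steps
    \<open>cc (2 * i + 3)\<close> and \<open>cc (2 * j + 3)\<close>, so goodness makes it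
    \<open>zz n\<close>.\<close>
  have "ch (\<rho> v) \<subseteq> ch (ev \<rho> a)" using summand_ev_subset[OF ab(3)] by simp
  moreover have "ev \<rho> a \<in> ch (ev \<rho> a \<bowtie> ev \<rho> b)"
    using hpar_right[of nil "ev \<rho> b" "ev \<rho> a"] ab(2) by (simp add: ch_xy)
  then have "ev \<rho> a \<in> ch (ev \<rho> u)"
    using ab(1) summand_ev_subset[of "a \<parallel> b" \<rho> u] summand_ev_subset[of "b \<parallel> a" \<rho> u]
      hpar_commute[of "ev \<rho> b"] by auto
  ultimately have "ev \<rho> a = zz n"
    using good v(2,3) ij(1-3) sound_eq_ev[OF snd pf, of \<rho>] unfolding good_def by (metis subsetD)
  then show ?thesis using ab(1,2) hpar_commute by metis
qed

lemma sound_eq_has_summand: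
  assumes snd: "sound_eq t u" and pf: "prefix_free t" "prefix_free u"
    and n: "2 \<le> n" "Suc (size t) < n" and good: "good n (ev \<rho> t)"
    and h: "\<And>v. h v \<Longrightarrow> ch (xy \<bowtie> zz n) \<subseteq> ch (\<rho> v)"
    and has_summand: "has_summand (xy \<bowtie> zz n) h \<rho> t"
  shows "has_summand (xy \<bowtie> zz n) h \<rho> u"
proof -
  from has_summand consider v where "Var v \<in> summands \<rho> t" "h v"
    | p q where "p \<parallel> q \<in> summands \<rho> t" "ev \<rho> p \<bowtie> ev \<rho> q = xy \<bowtie> zz n"
    unfolding has_summand_iff by blast
  then show ?thesis
  proof cases
    case (1 v)
    \<comment> \<open>A variable summand is transferred by probing it directly.\<close>
    define g where "g = Suc (depth (ev (\<rho>(v := nil)) u))"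
    define \<rho>' where "\<rho>' = \<rho>(v := node {cc g})"
    have "zz n \<in> ch (\<rho> v)"
      using h[OF 1(2)] hpar_left[OF nil_in_xy, of "zz n"] by auto
    then have v: "\<rho> v \<noteq> nil" by auto
    then have "\<rho>' x = nil \<longleftrightarrow> \<rho> x = nil" for x
      by (cases "x = v") (auto simp: \<rho>'_def simp flip: ch_eq_empty)
    then have "Var v \<in> summands \<rho>' t"
      using 1(1) summands_cong[OF pf(1), of \<rho>' \<rho>] by blast
    from summand_ev_subset[OF this] have "cc g \<in> ch (ev \<rho>' t)"
      by (simp add: \<rho>'_def)
    then have "cc g \<in> ch (ev (\<rho>(v := node {cc g})) u)"
      using sound_eq_ev[OF snd pf] unfolding \<rho>'_def by metis
    then have "Var v \<in> summands \<rho> u"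
      by (intro probe_var_summand[of u \<rho> v g, OF pf(2) v]) (simp_all add: g_def del: fun_upd_apply)
    then show ?thesis using 1(2) unfolding has_summand_iff by blast
  next
    case (2 p q)
    have "ev \<rho> p = xy \<and> ev \<rho> q = zz n \<or> ev \<rho> p = zz n \<and> ev \<rho> q = xy"
      using 2 summand_par_nonnil n(1)
      by (intro two_factors nil_in_xy xy_neq_zz) (auto simp: ch_zz)
    then have "\<exists>a b. a \<parallel> b \<in> summands \<rho> u \<and> ev \<rho> a \<bowtie> ev \<rho> b = xy \<bowtie> zz n"
      using sound_eq_par_summand[OF snd pf n good] 2(1) by blast
    then show ?thesis unfolding has_summand_iff by blast
  qed
qed

lemma sound_eq_sym: "sound_eq t u \<Longrightarrow> sound_eq u t"
proof -
  assume tu: "sound_eq t u"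
  have "RWB q p" if "RWB p q" for p q :: "'a trm"
    using that WB_sym unfolding RWB_def by meson
  then show "sound_eq u t" using tu unfolding sound_eq_def by blast
qed

text \<open>Prefix-freeness and equal values are carried along to make goodness pass through
  transitivity. The size bound counts both sides because the equivalence uses each axiom in both
  directions.\<close>

lemma derives_invariant:
  assumes "E \<turnstile> t \<approx> u" and "sound E" and n: "2 \<le> n"
    and size: "\<And>t u. (t, u) \<in> E \<Longrightarrow> Suc (size t + size u) < n"
  shows "(prefix_free t \<longleftrightarrow> prefix_free u) \<and>
    (prefix_free t \<longrightarrow> ev \<rho> t = ev \<rho> u \<and>
      (good n (ev \<rho> t) \<longrightarrow>
        has_summand (xy \<bowtie> zz n) (\<lambda>_. False) \<rho> t = has_summand (xy \<bowtie> zz n) (\<lambda>_. False) \<rho> u))"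
  using assms(1)
proof (induction rule: derives.induct)
  case (axm t u \<sigma>)
  have snd: "sound_eq t u" using axm \<open>sound E\<close> unfolding sound_def by auto
  note pf_iff = sound_eq_prefix_free[OF snd]
  \<comment> \<open>Making a single variable non-nil detects its occurrence; equal variables make
    the two instances prefix-free together.\<close>
  have vars: "vars t = vars u" if pf: "prefix_free t" "prefix_free u"
  proof -
    have "v \<in> vars t \<longleftrightarrow> v \<in> vars u" for v
    proof -
      have "ev (\<lambda>w. if w = v then cc 1 else nil) s = nil \<longleftrightarrow> v \<notin> vars s"
        if "prefix_free s" for s :: "'a trm"
        using ev_eq_nil[OF that] by (simp add: split: if_splits) auto
      then show ?thesis using sound_eq_ev[OF snd pf] pf by metis
    qed
    then show ?thesis by blast
  qed
  define h where "h v = has_summand (xy \<bowtie> zz n) (\<lambda>_. False) \<rho> (\<sigma> v)" for v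
  have h: "ch (xy \<bowtie> zz n) \<subseteq> ch (ev \<rho> (\<sigma> v))" if "h v" for v
    using has_summand_subset[of "xy \<bowtie> zz n" "\<lambda>_. False" \<rho> "\<sigma> v"] that by (simp add: h_def)
  show ?case
  proof (cases "prefix_free t")
    case False
    then show ?thesis using pf_iff by (simp add: prefix_free_subst)
  next
    case True
    then have pf: "prefix_free t" "prefix_free u" using pf_iff by auto
    let ?\<rho> = "\<lambda>v. ev \<rho> (\<sigma> v)"
    have eq: "ev ?\<rho> t = ev ?\<rho> u" by (rule sound_eq_ev[OF snd pf])
    have "has_summand (xy \<bowtie> zz n) h ?\<rho> t = has_summand (xy \<bowtie> zz n) h ?\<rho> u" if "good n (ev ?\<rho> t)"
      using sound_eq_has_summand[OF snd pf n _ that h] size[OF axm] that eq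
        sound_eq_has_summand[OF sound_eq_sym[OF snd] pf(2,1) n _ _ h] by auto
    then show ?thesis
      using vars[OF pf] pf eq unfolding ev_subst has_summand_subst prefix_free_subst h_def by blast
  qed
next
  case (cong_plus t u t' u')
  then show ?case by (auto simp: good_hplus)
next
  \<comment> \<open>For non-nil components only values matter; if one is \<open>nil\<close>, the
    other has the value of the whole and inherits goodness.\<close>
  case (cong_par t u t' u')
  then show ?case by auto
qed auto

section \<open>The two sides of the equation\<close>

lemma ev_tsum: "ch (ev \<rho> (tsum f n)) = (\<Union>i\<in>{1..n}. ch (ev \<rho> (f i)))"
  by (induction f n rule: tsum.induct) (auto simp: atLeastAtMostSuc_conv)

lemma has_summand_tsum: "has_summand w h \<rho> (tsum f n) \<longleftrightarrow> (\<exists>i\<in>{1..n}. has_summand w h \<rho> (f i))"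
  by (induction f n rule: tsum.induct) (auto simp: atLeastAtMostSuc_conv)

lemma prefix_free_tsum: "(\<And>i. prefix_free (f i)) \<Longrightarrow> prefix_free (tsum f n)"
  by (induction f n rule: tsum.induct) auto

lemma cc_in_hpar:
  assumes "cc k \<in> ch (p \<bowtie> q)" "0 < k"
  shows "p = nil \<and> cc k \<in> ch q \<or> q = nil \<and> cc k \<in> ch p \<or> p = cc k \<and> nil \<in> ch q \<or> q = cc k \<and> nil \<in> ch p"
  using assms(1)
proof (cases rule: hpar_cases)
  case (1 p')
  then show ?thesis using irreducible[OF 1(2)[symmetric]] assms(2) nil_in_cc by metis
next
  case (2 q')
  then show ?thesis using irreducible[OF 2(2)[symmetric]] assms(2) nil_in_cc by metis
qed

text \<open>If a \<open>z\<close> part moved (\<open>middle\<close>), its residual \<open>c\<close>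
  would equal two different \<open>cc\<close>. If \<open>x\<close> or \<open>y\<close> moved
  (\<open>outer\<close>), parity and \<open>zz_neq_cc\<close> force its residual to be
  \<open>nil\<close>; then \<open>q\<close> is \<open>zz n\<close> or a single \<open>z\<close>
  value, which has only one non-nil step.\<close>

lemma good_lhs:
  assumes n: "2 \<le> n"
    and sub: "ch p \<subseteq> ch (xy \<bowtie> zz n) \<union>
      (\<Union>k\<in>{1..n}. ch (cc 2 \<bowtie> cc (2 * k + 4)) \<union> ch (cc 3 \<bowtie> cc (2 * k + 4)))"
  shows "good n p"
  unfolding good_def
proof (intro ballI impI)
  fix q i j
  assume "q \<in> ch p" and ij: "i \<in> {1..n}" "j \<in> {1..n}" "i \<noteq> j"
    and qi: "cc (2 * i + 3) \<in> ch q" and qj: "cc (2 * j + 3) \<in> ch q"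
  have middle: False if q: "q = u \<bowtie> c" and u: "depth u = 2 \<or> depth u = 3"
    and c: "c \<in> ch (cc (2 * k + 4)) \<or> c \<in> ch (zz n)" for u c k
  proof -
    have "c = cc (2 * m + 3)" if "cc (2 * m + 3) \<in> ch q" "1 \<le> m" for m
    proof -
      have "u \<noteq> nil" "u \<noteq> cc (2 * m + 3)" "cc (2 * m + 3) \<notin> ch u"
        using u that(2) by (auto dest: depth_less)
      then show ?thesis using cc_in_hpar[of "2 * m + 3" u c] that(1) q by auto
    qed
    from this[OF qi] this[OF qj] show False using ij by auto
  qed
  have outer: "u = nil" if q: "q = u \<bowtie> c" and u: "u = nil \<or> u = cc 1 \<or> u = cc 2"
    and c: "c = zz n \<or> c = cc (2 * k + 4)" for u c k
  proof (rule ccontr)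
    assume "u \<noteq> nil"
    moreover have "u \<noteq> cc (2 * i + 3)" "cc (2 * i + 3) \<notin> ch u"
      using u by (auto dest: depth_less)
    moreover have "c \<noteq> nil" using c zz_neq_nil[OF n] by auto
    ultimately have "c = cc (2 * i + 3)" using cc_in_hpar[of "2 * i + 3" u c] qi q by auto
    then have "cc (2 * i + 3) = cc (2 * k + 4)" using c zz_neq_cc[OF n] by metis
    then have "2 * i + 3 = 2 * k + 4" by (simp only: cc_inject)
    then show False by presburger
  qed
  consider "q \<in> ch (xy \<bowtie> zz n)"
    | x k where "q \<in> ch (x \<bowtie> cc (2 * k + 4))" "x = cc 2 \<or> x = cc 3"
    using \<open>q \<in> ch p\<close> sub by blast
  then show "q = zz n"
  proof cases
    case 1
    then show ?thesis
    proof (cases rule: hpar_cases)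
      case (1 u)
      then show ?thesis using outer[of u "zz n"] by (auto simp: ch_xy)
    next
      case (2 c)
      then show ?thesis using middle[of xy c] by auto
    qed
  next
    case (2 x k)
    from 2(1) show ?thesis
    proof (cases rule: hpar_cases)
      case (1 u)
      have "u = nil" using outer[OF 1(2), of k] 1(1) 2(2) by (auto simp: ch_cc)
      then have "cc (2 * i + 3) \<in> ch (cc (2 * k + 4))" "cc (2 * j + 3) \<in> ch (cc (2 * k + 4))"
        using qi qj 1(2) by simp_all
      then show ?thesis using ij by (simp add: ch_cc)
    next
      case c: (2 c)
      then show ?thesis using middle[OF c(2), of k] 2(2) by auto
    qed
  qed
qed

theorem theorem11:
  fixes E :: "('a trm \<times> 'a trm) set"
  assumes "finite E"
    and "sound E"
  shows "\<exists>n\<ge>1. \<forall>x y z. distinct (x # y # map z [1..<Suc n])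
           \<longrightarrow> \<not> (E \<turnstile> M_lhs n x y z \<approx> M_rhs n x y z)"
proof -
  \<comment> \<open>\<open>insert 0\<close> covers an empty \<open>E\<close>; adding 2 gives
    \<open>2 \<le> n\<close> and the strict bound despite its \<open>Suc\<close>.\<close>
  define n where "n = Max (insert 0 ((\<lambda>(t, u). size t + size u) ` E)) + 2"
  have n: "2 \<le> n" by (simp add: n_def)
  have size: "Suc (size t + size u) < n" if "(t, u) \<in> E" for t u
  proof -
    have "size t + size u \<le> Max (insert 0 ((\<lambda>(t, u). size t + size u) ` E))"
      using that assms(1) by (intro Max_ge) (auto intro: rev_image_eqI)
    then show ?thesis by (simp add: n_def)
  qed
  have "\<not> (E \<turnstile> M_lhs n x y z \<approx> M_rhs n x y z)" if dist: "distinct (x # y # map z [1..<Suc n])" for x y z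
  proof
    assume der: "E \<turnstile> M_lhs n x y z \<approx> M_rhs n x y z"
    have inj: "inj_on z {1..n}"
      using dist by (auto simp: distinct_map atLeastLessThanSuc_atLeastAtMost simp del: upt_Suc)
    have fresh: "x \<noteq> y" "\<And>i. i \<in> {1..n} \<Longrightarrow> z i \<noteq> x \<and> z i \<noteq> y"
      using dist by (auto simp: atLeastLessThanSuc_atLeastAtMost simp del: upt_Suc)
    \<comment> \<open>\<open>inv_into\<close> recovers the index \<open>i\<close> from the variable
      \<open>z i\<close>.\<close>
    define \<rho> where "\<rho> w = (if w = x then cc 2 else if w = y then cc 3
      else cc (2 * inv_into {1..n} z w + 4))" for w
    have \<rho>: "\<rho> x = cc 2" "\<rho> y = cc 3" "\<And>i. i \<in> {1..n} \<Longrightarrow> \<rho> (z i) = cc (2 * i + 4)"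
      using fresh inj by (auto simp: \<rho>_def)
    have z_sum: "ev \<rho> (tsum (\<lambda>i. Var (z i) :: 'a trm) n) = zz n"
    proof -
      have "ch (ev \<rho> (tsum (\<lambda>i. Var (z i) :: 'a trm) n)) = (\<Union>i\<in>{1..n}. {nil, cc (2 * i + 3)})"
        unfolding ev_tsum by (rule SUP_cong) (simp_all add: \<rho>(3) ch_cc add.commute)
      also have "\<dots> = ch (zz n)" using n by (auto simp: ch_zz)
      finally show ?thesis by simp
    qed
    have pf: "prefix_free (M_lhs n x y z :: 'a trm)"
      by (simp add: M_lhs_def prefix_free_tsum)
    have "good n (ev \<rho> (M_lhs n x y z :: 'a trm))"
    proof (rule good_lhs[OF n])
      show "ch (ev \<rho> (M_lhs n x y z :: 'a trm)) \<subseteq> ch (xy \<bowtie> zz n) \<union>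
        (\<Union>k\<in>{1..n}. ch (cc 2 \<bowtie> cc (2 * k + 4)) \<union> ch (cc 3 \<bowtie> cc (2 * k + 4)))"
        by (auto simp: M_lhs_def ev_tsum z_sum \<rho> xy_def)
    qed
    moreover have "has_summand (xy \<bowtie> zz n) (\<lambda>_. False) \<rho> (M_lhs n x y z :: 'a trm)"
      using zz_neq_nil[OF n] by (simp add: M_lhs_def z_sum \<rho> xy_def)
    ultimately have "has_summand (xy \<bowtie> zz n) (\<lambda>_. False) \<rho> (M_rhs n x y z :: 'a trm)"
      using derives_invariant[OF der assms(2) n size, of \<rho>] pf by blast
    then consider "cc 2 \<bowtie> zz n = xy \<bowtie> zz n" | "cc 3 \<bowtie> zz n = xy \<bowtie> zz n"
      | i where "xy \<bowtie> cc (2 * i + 4) = xy \<bowtie> zz n"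
      using zz_neq_nil[OF n] by (auto simp: M_rhs_def has_summand_tsum z_sum \<rho> xy_def)
    moreover have "p = xy \<and> q = zz n \<or> p = zz n \<and> q = xy"
      if "p \<bowtie> q = xy \<bowtie> zz n" "p \<noteq> nil" "q \<noteq> nil" for p q
      using that n by (intro two_factors nil_in_xy xy_neq_zz) (auto simp: ch_zz)
    \<comment> \<open>Unique decomposition would make \<open>cc 2\<close>, \<open>cc 3\<close> or
      \<open>cc (2 * i + 4)\<close> equal to \<open>xy\<close> or \<open>zz n\<close>.\<close>
    ultimately show False
      using xy_neq_cc[symmetric] zz_neq_cc[OF n, symmetric] zz_neq_nil[OF n] xy_neq_zz[OF n] nil_in_xy
      by cases (metis cc_eq_nil(1) zero_neq_numeral add_is_0 ch_nil empty_iff)+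
  qed
  then show ?thesis using n by (intro exI[of _ n]) auto
qed

end
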